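(* Assume conditions (S1)--(S4) of the context and let $C^*=1/(1+\sqrt K)$. The separatrix $$\Sigma=\{\pi\in\Delta_{m-1}: C(\pi,\gamma)=C^*\text{ for all }\gamma\in(0,1)\}$$ is a non-empty convex subset of $\Delta_{m-1}$ characterized by: (i) one ratio constraint per involutive orbit $\{z,\sigma(z)\}$ with $\sigma(z)\ne z$, namely $\pi_z:\pi_{\sigma(z)}=\sqrt{\kappa(\sigma(z))}:\sqrt{\kappa(z)}$, i.e. $$\sqrt{\kappa(z)}\,\pi_z=\sqrt{\kappa(\sigma(z))}\,\pi_{\sigma(z)};$$ (ii) no constraint on neutral sites ($\sigma(z_0)=z_0$), except normalization. That is, $\pi\in\Delta_{m-1}$ belongs to $\Sigma$ if and only if (i) holds for every orbit of size two. In particular, $\Sigma$ is an affine simplex of dimension $n_{\mathrm{pair}}+n_{\mathrm{neutral}}-1$, where $n_{\mathrm{pair}}$ is the number of orbits of $\sigma$ of size two and $n_{\mathrm{neutral}}$ the number of neutral (fixed) sites: the ratio constraint within each orbit fixes the internal split of that orbit's mass but leaves the total orbit mass free, and together with the masses of the neutral sites these $n_{\mathrm{pair}}+n_{\mathrm{neutral}}$ total masses parametrize $\Sigma$, subject only to normalization. When there is a single orbit and no neutral site ($m=2$), $\Sigma$ consists of a single point.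
   Context: Let $m\ge 2$, let $z_1,\dots,z_m$ be distinct points (the reset sites), $\Delta_{m-1}=\{\pi\in\mathbb{R}^m:\pi_i\ge 0,\ \sum_i\pi_i=1\}$, and $\Delta_{m-1}^\circ$ its relative interior (all $\pi_i>0$). For a site $z=z_i$ write $\pi_z=\pi_i$. The coupling functional is a smooth functional $C:\Delta_{m-1}\times(0,1)\to\mathbb{R}$, $(\pi,\gamma)\mapsto C(\pi,\gamma)$. Conditions: (S1) For each fixed $\gamma\in(0,1)$ the map $\pi\mapsto C(\pi,\gamma)$ is of class $\mathcal{C}^1$ on $\Delta_{m-1}^\circ$ and extends continuously to the boundary. (S2) There are functions $u(z;\gamma), s(z;\gamma)$ with $C(\pi,\gamma)=\dfrac{\sum_{i}\pi_i u(z_i;\gamma)}{\sum_{i}\pi_i s(z_i;\gamma)}$, the denominator being strictly positive for all $\pi\in\Delta_{m-1}$, $\gamma\in(0,1)$. Moreover $u(z;\gamma)=\sum_{\nu=1}^N f_\nu(\gamma)A_\nu(z)$ and $s(z;\gamma)=\sum_{\nu=1}^N f_\nu(\gamma)(A_\nu(z)+B_\nu(z))$ with $N\ge 1$ and real coefficients $A_\nu(z),B_\nu(z)$, where the functions $f_1,\dots,f_N$ are linearly independent on $(0,1)$ and the $m$ vectors $(A_\nu(z_i))_{\nu=1}^N$, $i=1,\dots,m$, are linearly independent in $\mathbb{R}^N$ (so $m\le N$). (S3) There are an involution $\sigma$ of the set of reset sites ($\sigma^2=\mathrm{id}$), with at least one site $z$ such that $\sigma(z)\ne z$, and weights $\kappa(z)>0$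 independent of $\nu$, such that $B_\nu(z)=\kappa(z)A_\nu(\sigma(z))$ for all $\nu$ and all reset sites $z$. (S4) There is a constant $K>0$, the same for all reset sites, such that $\kappa(z)\kappa(\sigma(z))=K$ for all reset sites $z$. A site $z_0$ with $\sigma(z_0)=z_0$ is called neutral. *)

theory Defs
  imports "HOL-Analysis.Analysis"
begin

text \<open>
  The reset sites are the values of an injective family \<open>z :: 'm \<Rightarrow> 'p\<close> over a finite index type,
  so \<open>m = CARD('m)\<close>, and \<open>real ^ 'm\<close> is the space containing the simplex.
  Likewise \<open>N = CARD('k)\<close> for the index type \<open>'k\<close> of the functions \<open>f \<nu>\<close>.
\<close>

definition prob_simplex :: "(real ^ 'm::finite) set" where
  "prob_simplex = {\<pi>. (\<forall>i. 0 \<le> \<pi> $ i) \<and> (\<Sum>i\<in>UNIV. \<pi> $ i) = 1}"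

text \<open>The weight that \<open>\<pi>\<close> gives to the site \<open>w\<close>; meaningful for \<open>inj z\<close> and \<open>w \<in> range z\<close>.\<close>

definition site_mass :: "('m::finite \<Rightarrow> 'p) \<Rightarrow> real ^ 'm \<Rightarrow> 'p \<Rightarrow> real" where
  "site_mass z \<pi> w = \<pi> $ (inv z w)"

text \<open>
  The relative interior of the simplex is not open in \<open>real ^ 'm\<close>, so differentiability is taken
  within the set. Only the restriction of \<open>D x\<close> to directions tangent to \<open>S\<close> is then determined;
  a continuous choice on the tangent space always extends (by zero on the orthogonal complement)
  to a continuous \<open>D\<close> on the whole space.
\<close>

definition C1_on :: "'a::real_normed_vector set \<Rightarrow> ('a \<Rightarrow> real) \<Rightarrow> bool" where
  "C1_on S F \<longleftrightarrow>
     (\<exists>D :: 'a \<Rightarrow> 'a \<Rightarrow>\<^sub>L real.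
        (\<forall>x\<in>S. (F has_derivative blinfun_apply (D x)) (at x within S)) \<and> continuous_on S D)"

definition cond_S1 :: "(real ^ 'm::finite \<Rightarrow> real \<Rightarrow> real) \<Rightarrow> bool" where
  "cond_S1 C \<longleftrightarrow>
     (\<forall>\<gamma>\<in>{0<..<1}. C1_on (rel_interior prob_simplex) (\<lambda>\<pi>. C \<pi> \<gamma>) \<and>
                   continuous_on prob_simplex (\<lambda>\<pi>. C \<pi> \<gamma>))"

definition lin_indep_funs :: "real set \<Rightarrow> ('k::finite \<Rightarrow> real \<Rightarrow> real) \<Rightarrow> bool" where
  "lin_indep_funs I f \<longleftrightarrow>
     (\<forall>c :: 'k \<Rightarrow> real. (\<forall>\<gamma>\<in>I. (\<Sum>\<nu>\<in>UNIV. c \<nu> * f \<nu> \<gamma>) = 0) \<longrightarrow> (\<forall>\<nu>. c \<nu> = 0))"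

text \<open>
  In the last conjunct, injectivity is needed to turn linear independence of the set of vectors
  into linear independence of the indexed family.
\<close>

definition cond_S2 ::
  "('m::finite \<Rightarrow> 'p) \<Rightarrow> (real ^ 'm \<Rightarrow> real \<Rightarrow> real) \<Rightarrow> ('p \<Rightarrow> real \<Rightarrow> real) \<Rightarrow> ('p \<Rightarrow> real \<Rightarrow> real) \<Rightarrow>
   ('k::finite \<Rightarrow> real \<Rightarrow> real) \<Rightarrow> ('k \<Rightarrow> 'p \<Rightarrow> real) \<Rightarrow> ('k \<Rightarrow> 'p \<Rightarrow> real) \<Rightarrow> bool" where
  "cond_S2 z C u s f A B \<longleftrightarrow>
     (\<forall>\<pi>\<in>prob_simplex. \<forall>\<gamma>\<in>{0<..<1}.
        (\<Sum>i\<in>UNIV. \<pi> $ i * s (z i) \<gamma>) > 0 \<and>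
        C \<pi> \<gamma> = (\<Sum>i\<in>UNIV. \<pi> $ i * u (z i) \<gamma>) / (\<Sum>i\<in>UNIV. \<pi> $ i * s (z i) \<gamma>)) \<and>
     (\<forall>w\<in>range z. \<forall>\<gamma>\<in>{0<..<1}.
        u w \<gamma> = (\<Sum>\<nu>\<in>UNIV. f \<nu> \<gamma> * A \<nu> w) \<and>
        s w \<gamma> = (\<Sum>\<nu>\<in>UNIV. f \<nu> \<gamma> * (A \<nu> w + B \<nu> w))) \<and>
     lin_indep_funs {0<..<1} f \<and>
     (let a = (\<lambda>i. \<chi> \<nu>. A \<nu> (z i)) :: 'm \<Rightarrow> real ^ 'k in inj a \<and> independent (range a))"

definition cond_S3 ::
  "'p set \<Rightarrow> ('p \<Rightarrow> 'p) \<Rightarrow> ('p \<Rightarrow> real) \<Rightarrow> ('k \<Rightarrow> 'p \<Rightarrow> real) \<Rightarrow> ('k \<Rightarrow> 'p \<Rightarrow> real) \<Rightarrow> bool" where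
  "cond_S3 Z \<sigma> \<kappa> A B \<longleftrightarrow>
     (\<forall>w\<in>Z. \<sigma> w \<in> Z \<and> \<sigma> (\<sigma> w) = w) \<and>
     (\<exists>w\<in>Z. \<sigma> w \<noteq> w) \<and>
     (\<forall>w\<in>Z. \<kappa> w > 0) \<and>
     (\<forall>\<nu>. \<forall>w\<in>Z. B \<nu> w = \<kappa> w * A \<nu> (\<sigma> w))"

definition cond_S4 :: "'p set \<Rightarrow> ('p \<Rightarrow> 'p) \<Rightarrow> ('p \<Rightarrow> real) \<Rightarrow> real \<Rightarrow> bool" where
  "cond_S4 Z \<sigma> \<kappa> K \<longleftrightarrow> K > 0 \<and> (\<forall>w\<in>Z. \<kappa> w * \<kappa> (\<sigma> w) = K)"

definition C_star :: "real \<Rightarrow> real" where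
  "C_star K = 1 / (1 + sqrt K)"

definition separatrix :: "(real ^ 'm::finite \<Rightarrow> real \<Rightarrow> real) \<Rightarrow> real \<Rightarrow> (real ^ 'm) set" where
  "separatrix C K = {\<pi> \<in> prob_simplex. \<forall>\<gamma>\<in>{0<..<1}. C \<pi> \<gamma> = C_star K}"

definition site_orbits :: "'p set \<Rightarrow> ('p \<Rightarrow> 'p) \<Rightarrow> 'p set set" where
  "site_orbits Z \<sigma> = (\<lambda>w. {w, \<sigma> w}) ` Z"

definition n_pair :: "'p set \<Rightarrow> ('p \<Rightarrow> 'p) \<Rightarrow> nat" where
  "n_pair Z \<sigma> = card {O' \<in> site_orbits Z \<sigma>. card O' = 2}"

definition n_neutral :: "'p set \<Rightarrow> ('p \<Rightarrow> 'p) \<Rightarrow> nat" where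
  "n_neutral Z \<sigma> = card {w \<in> Z. \<sigma> w = w}"

text \<open>The family of total orbit masses of \<open>\<pi>\<close>, extensional on the set of orbits.\<close>

definition orbit_masses ::
  "('m::finite \<Rightarrow> 'p) \<Rightarrow> ('p \<Rightarrow> 'p) \<Rightarrow> real ^ 'm \<Rightarrow> 'p set \<Rightarrow> real" where
  "orbit_masses z \<sigma> \<pi> = (\<lambda>O'\<in>site_orbits (range z) \<sigma>. \<Sum>w\<in>O'. site_mass z \<pi> w)"

end

theory Submission
  imports Defs
begin

text \<open>
  Clearing denominators, \<open>C = C\<^sup>*\<close> for all \<open>\<gamma>\<close> says that a combination of the \<open>f \<nu>\<close> vanishes
  identically. Linear independence of the \<open>f \<nu>\<close>, then re-indexing by \<open>\<sigma>\<close> and linear independence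
  of the vectors \<open>(A \<nu> (z i))\<^sub>\<nu>\<close>, turn this into
  \<open>sqrt K * \<pi>\<^sub>w = \<kappa> (\<sigma> w) * \<pi>\<^sub>\<sigma>\<^sub>w\<close>, which is the ratio constraint because
  \<open>sqrt K = sqrt (\<kappa> w) * sqrt (\<kappa> (\<sigma> w))\<close>. So inside each orbit \<open>\<pi>\<close> is proportional to
  \<open>1 / sqrt \<kappa>\<close>, and the separatrix is the convex hull of the probability vectors with this
  profile on a single orbit. These have disjoint supports, hence are linearly independent.
\<close>

section \<open>Probability vectors with prescribed profile on the blocks of a partition\<close>

text \<open>The blocks are the fibres of \<open>b\<close>, and \<open>p\<close> restricts to a probability vector on each.\<close>

locale block_profile =
  fixes b :: "'m::finite \<Rightarrow> 'o" and p :: "'m \<Rightarrow> real"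
  assumes p_pos: "p i > 0"
    and sum_p: "(\<Sum>i | b i = b j. p i) = 1"
begin

definition vertex :: "'o \<Rightarrow> real ^ 'm" where
  "vertex x = (\<chi> i. if b i = x then p i else 0)"

definition block_mass :: "real ^ 'm \<Rightarrow> 'o \<Rightarrow> real" where
  "block_mass \<pi> x = (\<Sum>j | b j = x. \<pi> $ j)"

text \<open>The product form, instead of prescribed quotients, keeps the condition linear in \<pi>
  and admits blocks of mass zero.\<close>

definition profile_set :: "(real ^ 'm) set" where
  "profile_set = {\<pi> \<in> prob_simplex. \<forall>i. \<pi> $ i = p i * block_mass \<pi> (b i)}"

definition combination :: "('o \<Rightarrow> real) \<Rightarrow> real ^ 'm" where
  "combination t = (\<Sum>x\<in>range b. t x *\<^sub>R vertex x)"

section \<open>Block masses as coordinates on the profile set\<close>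

lemma combination_nth [simp]: "combination t $ i = t (b i) * p i"
proof -
  have "combination t $ i = (\<Sum>x\<in>range b. if b i = x then t x * p i else 0)"
    unfolding combination_def vertex_def by (simp add: if_distrib cong: if_cong)
  then show ?thesis
    by simp
qed

text \<open>The profile \<open>p\<close> has total mass 1 on each block. This makes
  \<open>block_mass\<close> a left inverse of \<open>combination\<close>; outside
  \<open>range b\<close> the fibre is empty and its mass is 0.\<close>

lemma block_mass_combination:
  assumes "x \<in> range b"
  shows "block_mass (combination t) x = t x"
proof -
  obtain j where j: "x = b j"
    using assms by auto
  have "block_mass (combination t) x = (\<Sum>i | b i = b j. t (b j) * p i)"
    unfolding block_mass_def j by (rule sum.cong) auto
  also have "\<dots> = t (b j)"
    by (simp add: sum_p flip: sum_distrib_left)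
  finally show ?thesis
    by (simp add: j)
qed

lemma sum_block_mass: "(\<Sum>x\<in>range b. block_mass \<pi> x) = (\<Sum>i\<in>UNIV. \<pi> $ i)"
  using sum.group[of UNIV "range b" b "\<lambda>i. \<pi> $ i"] unfolding block_mass_def by simp

lemma combination_in_profile_set:
  assumes "\<And>x. x \<in> range b \<Longrightarrow> 0 \<le> t x" and "(\<Sum>x\<in>range b. t x) = 1"
  shows "combination t \<in> profile_set"
proof -
  have "(\<Sum>i\<in>UNIV. combination t $ i) = (\<Sum>x\<in>range b. block_mass (combination t) x)"
    by (rule sum_block_mass [symmetric])
  also have "\<dots> = 1"
    using assms(2) by (simp add: block_mass_combination cong: sum.cong)
  finally show ?thesis
    unfolding profile_set_def prob_simplex_def
    using assms(1) p_pos by (auto simp: block_mass_combination less_imp_le)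
qed

text \<open>Read coordinatewise, this is the defining equation of \<open>profile_set\<close>: such a
  vector is recovered from its block masses.\<close>

lemma combination_block_mass:
  assumes "\<pi> \<in> profile_set"
  shows "combination (block_mass \<pi>) = \<pi>"
  using assms by (auto simp: profile_set_def vec_eq_iff mult.commute)

lemma block_mass_nonneg: "\<pi> \<in> profile_set \<Longrightarrow> 0 \<le> block_mass \<pi> x"
  unfolding profile_set_def prob_simplex_def block_mass_def by (blast intro: sum_nonneg)

lemma sum_block_mass_profile_set:
  "\<pi> \<in> profile_set \<Longrightarrow> (\<Sum>x\<in>range b. block_mass \<pi> x) = 1"
  unfolding sum_block_mass profile_set_def prob_simplex_def by blast

lemma combination_cong:
  fixes t t' :: "'o \<Rightarrow> real"
  assumes "\<And>x. x \<in> range b \<Longrightarrow> t x = t' x"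
  shows "combination t = combination t'"
  unfolding combination_def using assms by (auto intro: sum.cong)

text \<open>\<open>combination\<close> is the inverse map. Restricting to \<open>range b\<close>
  makes mass families extensional, so that equality on the blocks is equality of functions.\<close>

lemma bij_betw_block_mass:
  "bij_betw (\<lambda>\<pi>. restrict (block_mass \<pi>) (range b)) profile_set
     {t \<in> range b \<rightarrow>\<^sub>E {0..}. (\<Sum>x\<in>range b. t x) = 1}"
proof (rule bij_betw_byWitness[where f' = combination])
  show "\<forall>\<pi>\<in>profile_set. combination (restrict (block_mass \<pi>) (range b)) = \<pi>"
  proof
    fix \<pi> assume "\<pi> \<in> profile_set"
    moreover have "combination (restrict (block_mass \<pi>) (range b)) = combination (block_mass \<pi>)"
      by (rule combination_cong) simp
    ultimately show "combination (restrict (block_mass \<pi>) (range b)) = \<pi>"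
      by (simp add: combination_block_mass)
  qed
  show "\<forall>t\<in>{t \<in> range b \<rightarrow>\<^sub>E {0..}. (\<Sum>x\<in>range b. t x) = 1}.
          restrict (block_mass (combination t)) (range b) = t"
  proof (rule ballI, rule ext)
    fix t :: "'o \<Rightarrow> real" and x assume "t \<in> {t \<in> range b \<rightarrow>\<^sub>E {0..}. (\<Sum>x\<in>range b. t x) = 1}"
    then have "t \<in> extensional (range b)"
      by (simp add: PiE_def)
    \<comment> \<open>Off \<open>range b\<close> both sides are \<open>undefined\<close>.\<close>
    then show "restrict (block_mass (combination t)) (range b) x = t x"
      using block_mass_combination[of x t] extensional_arb[of t "range b" x]
      by (cases "x \<in> range b") (simp_all)
  qed
  show "(\<lambda>\<pi>. restrict (block_mass \<pi>) (range b)) ` profile_set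
          \<subseteq> {t \<in> range b \<rightarrow>\<^sub>E {0..}. (\<Sum>x\<in>range b. t x) = 1}"
  proof (rule image_subsetI, rule CollectI, rule conjI)
    fix \<pi> assume \<pi>: "\<pi> \<in> profile_set"
    show "restrict (block_mass \<pi>) (range b) \<in> range b \<rightarrow>\<^sub>E {0..}"
      using block_mass_nonneg[OF \<pi>] by (intro restrict_PiE_iff[THEN iffD2]) simp
    show "(\<Sum>x\<in>range b. restrict (block_mass \<pi>) (range b) x) = 1"
      using sum_block_mass_profile_set[OF \<pi>] by simp
  qed
  show "combination ` {t \<in> range b \<rightarrow>\<^sub>E {0..}. (\<Sum>x\<in>range b. t x) = 1} \<subseteq> profile_set"
  proof (rule image_subsetI, rule combination_in_profile_set)
    fix t :: "'o \<Rightarrow> real" and x assume t: "t \<in> {t \<in> range b \<rightarrow>\<^sub>E {0..}. (\<Sum>x\<in>range b. t x) = 1}"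
    then show "(\<Sum>x\<in>range b. t x) = 1"
      by blast
    show "0 \<le> t x" if "x \<in> range b"
      using t that PiE_mem[of t "range b" "\<lambda>_. {0..}" x] by simp
  qed
qed

section \<open>Convexity and simplex structure\<close>

lemma convex_profile_set: "convex profile_set"
proof (rule convexI)
  fix x y :: "real ^ 'm" and s r :: real
  assume xy: "x \<in> profile_set" "y \<in> profile_set" and sr: "0 \<le> s" "0 \<le> r" "s + r = 1"
  \<comment> \<open>Block masses are linear in the vector, hence so are the profile
    equations.\<close>
  have mass: "block_mass (s *\<^sub>R x + r *\<^sub>R y) o' = s * block_mass x o' + r * block_mass y o'" for o'
    by (simp add: block_mass_def sum.distrib sum_distrib_left)
  have "(s *\<^sub>R x + r *\<^sub>R y) $ i = p i * block_mass (s *\<^sub>R x + r *\<^sub>R y) (b i)" for i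
  proof -
    have "x $ i = p i * block_mass x (b i)" "y $ i = p i * block_mass y (b i)"
      using xy unfolding profile_set_def by blast+
    then show ?thesis
      by (simp add: mass distrib_left mult.left_commute)
  qed
  moreover have "s *\<^sub>R x + r *\<^sub>R y \<in> prob_simplex"
  proof -
    have "(\<Sum>i\<in>UNIV. (s *\<^sub>R x + r *\<^sub>R y) $ i) = s * (\<Sum>i\<in>UNIV. x $ i) + r * (\<Sum>i\<in>UNIV. y $ i)"
      by (simp add: sum.distrib sum_distrib_left)
    moreover have "(\<Sum>i\<in>UNIV. x $ i) = 1" "(\<Sum>i\<in>UNIV. y $ i) = 1" "\<And>i. 0 \<le> x $ i" "\<And>i. 0 \<le> y $ i"
      using xy unfolding profile_set_def prob_simplex_def by blast+
    ultimately show ?thesis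
      using sr unfolding prob_simplex_def by simp
  qed
  ultimately show "s *\<^sub>R x + r *\<^sub>R y \<in> profile_set"
    unfolding profile_set_def by blast
qed

lemma vertex_in_profile_set:
  assumes "x \<in> range b"
  shows "vertex x \<in> profile_set"
proof -
  \<comment> \<open>A vertex is the case where one block carries the whole mass.\<close>
  have "vertex x = combination (\<lambda>y. if y = x then 1 else 0)"
    by (auto simp: vec_eq_iff vertex_def)
  also have "\<dots> \<in> profile_set"
    using assms by (intro combination_in_profile_set) auto
  finally show ?thesis .
qed

text \<open>The block masses of a point are nonnegative, sum to 1, and serve as its barycentric
  coordinates with respect to the vertices.\<close>

lemma profile_set_eq_hull: "profile_set = convex hull (vertex ` range b)"
proof
  show "profile_set \<subseteq> convex hull (vertex ` range b)"
  proof
    fix \<pi> assume \<pi>: "\<pi> \<in> profile_set"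
    have "(\<Sum>x\<in>range b. block_mass \<pi> x *\<^sub>R vertex x) \<in> convex hull (vertex ` range b)"
      using \<pi> by (intro convex_sum) (auto simp: sum_block_mass_profile_set block_mass_nonneg
          intro: hull_inc)
    then show "\<pi> \<in> convex hull (vertex ` range b)"
      using combination_block_mass[OF \<pi>] by (simp add: combination_def)
  qed
  show "convex hull (vertex ` range b) \<subseteq> profile_set"
    using vertex_in_profile_set by (intro hull_minimal convex_profile_set) blast
qed

lemma combination_eq_0:
  assumes "combination t = 0" and "x \<in> range b"
  shows "t x = 0"
  using assms block_mass_combination[of x t] by (simp add: block_mass_def)

lemma inj_on_vertex: "inj_on vertex (range b)"
proof (rule inj_onI)
  fix x y assume xy: "x \<in> range b" "y \<in> range b" "vertex x = vertex y"
  then obtain i where i: "x = b i"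
    by auto
  \<comment> \<open>Positivity of \<open>p\<close> makes the support of a vertex its whole block, so
    the support determines the block.\<close>
  have "vertex x $ i \<noteq> 0"
    using p_pos[of i] by (simp add: i vertex_def)
  then have "vertex y $ i \<noteq> 0"
    unfolding xy(3) .
  then show "x = y"
    by (auto simp: i vertex_def split: if_splits)
qed

lemma independent_vertices: "independent (vertex ` range b)"
proof (rule independent_if_scalars_zero)
  fix c v assume c: "(\<Sum>y\<in>vertex ` range b. c y *\<^sub>R y) = 0" and v: "v \<in> vertex ` range b"
  have "combination (c \<circ> vertex) = 0"
    using c by (simp add: combination_def sum.reindex[OF inj_on_vertex])
  then show "c v = 0"
    using combination_eq_0 v by fastforce
qed simp

text \<open>Linear independence of the vertices gives affine independence; the dimension is one less
  than the number of vertices, which is the number of blocks.\<close>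

lemma simplex_profile_set: "(int (card (range b)) - 1) simplex profile_set"
  unfolding simplex_def
proof (intro exI conjI)
  show "\<not> affine_dependent (vertex ` range b)"
    using affine_dependent_imp_dependent independent_vertices by blast
  show "profile_set = convex hull (vertex ` range b)"
    by (rule profile_set_eq_hull)
  show "int (card (vertex ` range b)) = int (card (range b)) - 1 + 1"
    by (simp add: card_image inj_on_vertex)
qed

lemma profile_set_nonempty: "profile_set \<noteq> {}"
  using vertex_in_profile_set by blast

end

section \<open>Orbits of an involution\<close>

text \<open>An orbit either has two elements or is the singleton of a fixed point, and distinct
  fixed points give distinct singletons.\<close>

lemma card_site_orbits:
  assumes fin: "finite Z" and inv: "\<And>w. w \<in> Z \<Longrightarrow> \<sigma> w \<in> Z \<and> \<sigma> (\<sigma> w) = w"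
  shows "card (site_orbits Z \<sigma>) = n_pair Z \<sigma> + n_neutral Z \<sigma>"
proof -
  let ?P = "{Q \<in> site_orbits Z \<sigma>. card Q = 2}" and ?N = "(\<lambda>w. {w}) ` {w \<in> Z. \<sigma> w = w}"
  have "site_orbits Z \<sigma> = ?P \<union> ?N"
    by (auto simp: site_orbits_def card_insert_if image_iff)
  moreover have "?P \<inter> ?N = {}"
    by auto
  moreover have "finite ?P" "finite ?N"
    using fin by (auto simp: site_orbits_def)
  ultimately have "card (site_orbits Z \<sigma>) = card ?P + card ?N"
    by (metis (no_types, lifting) card_Un_disjoint)
  then show ?thesis
    by (simp add: n_pair_def n_neutral_def card_image)
qed

lemma orbit_eq_iff:
  assumes "\<sigma> (\<sigma> w) = w" "\<sigma> (\<sigma> w') = w'"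
  shows "{w, \<sigma> w} = {w', \<sigma> w'} \<longleftrightarrow> w = w' \<or> w = \<sigma> w'"
  using assms by (auto simp: doubleton_eq_iff)

text \<open>The counts leave exactly one orbit, of size two, and the sites are the union of the
  orbits.\<close>

lemma card_sites_single_pair:
  assumes "finite Z" and inv: "\<And>w. w \<in> Z \<Longrightarrow> \<sigma> w \<in> Z \<and> \<sigma> (\<sigma> w) = w"
    and "n_pair Z \<sigma> = 1" and "n_neutral Z \<sigma> = 0"
  shows "card Z = 2"
proof -
  obtain Q where Q: "{Q \<in> site_orbits Z \<sigma>. card Q = 2} = {Q}"
    using assms(3) unfolding n_pair_def by (rule card_1_singletonE)
  have "card (site_orbits Z \<sigma>) = 1"
    using card_site_orbits[OF assms(1) inv] assms(3,4) by simp
  then obtain R where "site_orbits Z \<sigma> = {R}"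
    by (rule card_1_singletonE)
  with Q have "site_orbits Z \<sigma> = {Q}" "card Q = 2"
    by auto
  moreover have "Z = \<Union> (site_orbits Z \<sigma>)"
    using inv by (auto simp: site_orbits_def)
  ultimately show ?thesis
    by simp
qed

section \<open>The ratio constraints\<close>

text \<open>Injectivity lets the coefficients be carried to the set \<open>range a\<close> by
  \<open>inv a\<close>, where independence of sets applies.\<close>

lemma independent_familyD:
  fixes a :: "'m::finite \<Rightarrow> 'v::real_vector"
  assumes "inj a" and "independent (range a)" and "(\<Sum>i\<in>UNIV. c i *\<^sub>R a i) = 0"
  shows "c j = 0"
proof -
  have "(\<Sum>v\<in>range a. c (inv a v) *\<^sub>R v) = 0"
    using assms(1,3) by (simp add: sum.reindex)
  then have "c (inv a (a j)) = 0"
    using assms(2) by (intro independentD[of "range a" "range a" "\<lambda>v. c (inv a v)"]) auto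
  then show ?thesis
    using assms(1) by simp
qed

text \<open>The left equation is the right one multiplied by \<open>sqrt k'\<close>. It is used with
  \<open>k * k' = K\<close>, the product of the weights of a site and its image.\<close>

lemma sqrt_ratio_iff:
  fixes k k' x y :: real
  assumes "k > 0" "k' > 0"
  shows "sqrt (k * k') * x = k' * y \<longleftrightarrow> sqrt k * x = sqrt k' * y"
proof -
  have "sqrt (k * k') * x = sqrt k' * (sqrt k * x)"
    by (simp only: real_sqrt_mult mult_ac)
  moreover have "k' * y = sqrt k' * (sqrt k' * y)"
    using assms by (simp flip: mult.assoc)
  ultimately have "sqrt (k * k') * x = k' * y \<longleftrightarrow> sqrt k' * (sqrt k * x) = sqrt k' * (sqrt k' * y)"
    by (simp only:)
  also have "\<dots> \<longleftrightarrow> sqrt k * x = sqrt k' * y"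
    using assms by simp
  finally show ?thesis .
qed

text \<open>All sites are quantified over here, neutral ones included; for those the equation is an
  identity.\<close>

lemma separatrix_iff_ratio:
  fixes z :: "'m::finite \<Rightarrow> 'p" and f :: "'k::finite \<Rightarrow> real \<Rightarrow> real"
  assumes z: "inj z" and S2: "cond_S2 z C u s f A B" and S3: "cond_S3 (range z) \<sigma> \<kappa> A B"
    and S4: "cond_S4 (range z) \<sigma> \<kappa> K" and \<pi>: "\<pi> \<in> prob_simplex"
  shows "\<pi> \<in> separatrix C K \<longleftrightarrow>
    (\<forall>w\<in>range z. sqrt (\<kappa> w) * site_mass z \<pi> w = sqrt (\<kappa> (\<sigma> w)) * site_mass z \<pi> (\<sigma> w))"
proof -
  \<comment> \<open>\<open>\<tau>\<close> is the involution \<sigma> transported to indices.\<close>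
  define \<tau> where "\<tau> i = inv z (\<sigma> (z i))" for i
  define a where "a i = (\<chi> \<nu>. A \<nu> (z i))" for i
  \<comment> \<open>\<open>d i\<close> is the coefficient of \<open>A \<nu> (z i)\<close> in the
    numerator times \<open>1 + sqrt K\<close> minus the denominator, once \<open>B\<close> is
    eliminated and the sum re-indexed.\<close>
  define d where "d i = sqrt K * \<pi> $ i - \<kappa> (z (\<tau> i)) * \<pi> $ \<tau> i" for i
  have z\<tau>: "z (\<tau> i) = \<sigma> (z i)" for i
    using S3 unfolding \<tau>_def cond_S3_def by (auto intro: f_inv_into_f)
  have \<tau>\<tau>: "\<tau> (\<tau> i) = i" for i
  proof (rule injD[OF z])
    show "z (\<tau> (\<tau> i)) = z i"
      using S3 by (simp add: z\<tau> cond_S3_def)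
  qed
  have \<kappa>: "\<kappa> (z i) > 0" and B: "B \<nu> (z i) = \<kappa> (z i) * A \<nu> (z (\<tau> i))" for i \<nu>
    using S3 by (auto simp: cond_S3_def z\<tau>)
  have K: "K > 0" "K = \<kappa> (z i) * \<kappa> (z (\<tau> i))" for i
    using S4 by (auto simp: cond_S4_def z\<tau>)
  \<comment> \<open>Moving \<tau> from the vector to its coefficient collects everything in the
    vectors \<open>a i\<close>, whose independence can then be used.\<close>
  have reindex: "(\<Sum>i\<in>UNIV. \<pi> $ i * (\<kappa> (z i) * A \<nu> (z (\<tau> i)))) =
      (\<Sum>i\<in>UNIV. \<pi> $ \<tau> i * (\<kappa> (z (\<tau> i)) * A \<nu> (z i)))" for \<nu>
    by (rule sum.reindex_bij_witness[of _ \<tau> \<tau>]) (auto simp: \<tau>\<tau>)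
  have C_iff: "C \<pi> \<gamma> = C_star K \<longleftrightarrow> (\<Sum>\<nu>\<in>UNIV. (\<Sum>i\<in>UNIV. d i *\<^sub>R a i) $ \<nu> * f \<nu> \<gamma>) = 0"
    if \<gamma>: "\<gamma> \<in> {0<..<1}" for \<gamma>
  proof -
    let ?U = "\<Sum>i\<in>UNIV. \<pi> $ i * u (z i) \<gamma>" and ?S = "\<Sum>i\<in>UNIV. \<pi> $ i * s (z i) \<gamma>"
    have S: "?S > 0" and C: "C \<pi> \<gamma> = ?U / ?S"
      using S2 \<pi> \<gamma> by (auto simp: cond_S2_def)
    have us: "u (z i) \<gamma> = (\<Sum>\<nu>\<in>UNIV. f \<nu> \<gamma> * A \<nu> (z i))"
      "s (z i) \<gamma> = (\<Sum>\<nu>\<in>UNIV. f \<nu> \<gamma> * (A \<nu> (z i) + B \<nu> (z i)))" for i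
      using S2 \<gamma> by (auto simp: cond_S2_def)
    have "?U = (\<Sum>i\<in>UNIV. \<Sum>\<nu>\<in>UNIV. f \<nu> \<gamma> * (\<pi> $ i * A \<nu> (z i)))"
      unfolding us by (simp add: sum_distrib_left mult_ac)
    also have "\<dots> = (\<Sum>\<nu>\<in>UNIV. f \<nu> \<gamma> * (\<Sum>i\<in>UNIV. \<pi> $ i * A \<nu> (z i)))"
      by (subst sum.swap) (simp add: sum_distrib_left)
    finally have U: "?U = (\<Sum>\<nu>\<in>UNIV. f \<nu> \<gamma> * (\<Sum>i\<in>UNIV. \<pi> $ i * A \<nu> (z i)))" .
    have "?S = (\<Sum>i\<in>UNIV. \<Sum>\<nu>\<in>UNIV. f \<nu> \<gamma> * (\<pi> $ i * A \<nu> (z i) + \<pi> $ i * (\<kappa> (z i) * A \<nu> (z (\<tau> i)))))"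
      unfolding us B by (simp add: sum_distrib_left algebra_simps)
    also have "\<dots> = (\<Sum>\<nu>\<in>UNIV. f \<nu> \<gamma> * (\<Sum>i\<in>UNIV. \<pi> $ i * A \<nu> (z i) + \<pi> $ i * (\<kappa> (z i) * A \<nu> (z (\<tau> i)))))"
      by (subst sum.swap) (simp add: sum_distrib_left)
    also have "\<dots> = (\<Sum>\<nu>\<in>UNIV. f \<nu> \<gamma> *
        (\<Sum>i\<in>UNIV. \<pi> $ i * A \<nu> (z i) + \<pi> $ \<tau> i * (\<kappa> (z (\<tau> i)) * A \<nu> (z i))))"
      by (simp add: sum.distrib reindex)
    finally have S': "?S = (\<Sum>\<nu>\<in>UNIV. f \<nu> \<gamma> *
        (\<Sum>i\<in>UNIV. \<pi> $ i * A \<nu> (z i) + \<pi> $ \<tau> i * (\<kappa> (z (\<tau> i)) * A \<nu> (z i))))" .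
    have "(1 + sqrt K) * ?U - ?S = (\<Sum>\<nu>\<in>UNIV. f \<nu> \<gamma> * (\<Sum>i\<in>UNIV. (1 + sqrt K) * (\<pi> $ i * A \<nu> (z i)) -
        (\<pi> $ i * A \<nu> (z i) + \<pi> $ \<tau> i * (\<kappa> (z (\<tau> i)) * A \<nu> (z i)))))"
      unfolding U S' sum_subtractf right_diff_distrib sum_distrib_left[symmetric]
      by (simp add: sum_distrib_left mult.left_commute)
    also have "\<dots> = (\<Sum>\<nu>\<in>UNIV. f \<nu> \<gamma> * (\<Sum>i\<in>UNIV. d i * A \<nu> (z i)))"
      by (simp add: d_def algebra_simps)
    also have "\<dots> = (\<Sum>\<nu>\<in>UNIV. (\<Sum>i\<in>UNIV. d i *\<^sub>R a i) $ \<nu> * f \<nu> \<gamma>)"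
      by (simp add: a_def mult.commute)
    finally have "(1 + sqrt K) * ?U - ?S = (\<Sum>\<nu>\<in>UNIV. (\<Sum>i\<in>UNIV. d i *\<^sub>R a i) $ \<nu> * f \<nu> \<gamma>)" .
    \<comment> \<open>Both denominators are positive, so cross-multiplication is an
      equivalence.\<close>
    moreover have "1 + sqrt K > 0"
      using K(1) by (simp add: add_pos_pos)
    ultimately show ?thesis
      using S unfolding C C_star_def by (auto simp: frac_eq_eq mult.commute)
  qed
  have "\<pi> \<in> separatrix C K \<longleftrightarrow>
      (\<forall>\<gamma>\<in>{0<..<1}. (\<Sum>\<nu>\<in>UNIV. (\<Sum>i\<in>UNIV. d i *\<^sub>R a i) $ \<nu> * f \<nu> \<gamma>) = 0)"
    using \<pi> C_iff by (auto simp: separatrix_def)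
  also have "\<dots> \<longleftrightarrow> (\<forall>\<nu>. (\<Sum>i\<in>UNIV. d i *\<^sub>R a i) $ \<nu> = 0)"
  proof
    have "lin_indep_funs {0<..<1} f"
      using S2 by (simp add: cond_S2_def)
    moreover assume "\<forall>\<gamma>\<in>{0<..<1}. (\<Sum>\<nu>\<in>UNIV. (\<Sum>i\<in>UNIV. d i *\<^sub>R a i) $ \<nu> * f \<nu> \<gamma>) = 0"
    ultimately show "\<forall>\<nu>. (\<Sum>i\<in>UNIV. d i *\<^sub>R a i) $ \<nu> = 0"
      unfolding lin_indep_funs_def by blast
  qed simp
  also have "\<dots> \<longleftrightarrow> (\<Sum>i\<in>UNIV. d i *\<^sub>R a i) = 0"
    by (simp only: vec_eq_iff zero_index)
  also have "\<dots> \<longleftrightarrow> (\<forall>i. d i = 0)"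
  proof
    have "inj a" "independent (range a)"
      using S2 unfolding cond_S2_def Let_def a_def[abs_def] by blast+
    moreover assume "(\<Sum>i\<in>UNIV. d i *\<^sub>R a i) = 0"
    ultimately show "\<forall>i. d i = 0"
      using independent_familyD by blast
  qed simp
  also have "\<dots> \<longleftrightarrow> (\<forall>i. sqrt (\<kappa> (z i)) * \<pi> $ i = sqrt (\<kappa> (z (\<tau> i))) * \<pi> $ \<tau> i)"
  proof -
    have "d i = 0 \<longleftrightarrow> sqrt (\<kappa> (z i)) * \<pi> $ i = sqrt (\<kappa> (z (\<tau> i))) * \<pi> $ \<tau> i" for i
      using sqrt_ratio_iff[OF \<kappa>[of i] \<kappa>[of "\<tau> i"], of "\<pi> $ i" "\<pi> $ \<tau> i", folded K(2)]
      by (simp add: d_def)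
    then show ?thesis
      by blast
  qed
  also have "\<dots> \<longleftrightarrow>
      (\<forall>w\<in>range z. sqrt (\<kappa> w) * site_mass z \<pi> w = sqrt (\<kappa> (\<sigma> w)) * site_mass z \<pi> (\<sigma> w))"
    using z by (simp add: site_mass_def z\<tau> flip: \<tau>_def)
  finally show ?thesis .
qed

section \<open>The separatrix as the profile set of the orbits\<close>

theorem proposition5p1:
  fixes z :: "'m::finite \<Rightarrow> 'p"
    and C :: "real ^ 'm \<Rightarrow> real \<Rightarrow> real"
    and u s :: "'p \<Rightarrow> real \<Rightarrow> real"
    and f :: "'k::finite \<Rightarrow> real \<Rightarrow> real"
    and A B :: "'k \<Rightarrow> 'p \<Rightarrow> real"
    and \<sigma> :: "'p \<Rightarrow> 'p"
    and \<kappa> :: "'p \<Rightarrow> real"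
    and K :: real
  assumes "CARD('m) \<ge> 2"
    and "inj z"
    and "cond_S1 C"
    and "cond_S2 z C u s f A B"
    and "cond_S3 (range z) \<sigma> \<kappa> A B"
    and "cond_S4 (range z) \<sigma> \<kappa> K"
  shows "separatrix C K \<noteq> {} \<and> convex (separatrix C K) \<and>
    (\<forall>\<pi>\<in>prob_simplex. \<pi> \<in> separatrix C K \<longleftrightarrow>
       (\<forall>w\<in>range z. \<sigma> w \<noteq> w \<longrightarrow>
          sqrt (\<kappa> w) * site_mass z \<pi> w = sqrt (\<kappa> (\<sigma> w)) * site_mass z \<pi> (\<sigma> w))) \<and>
    (int (n_pair (range z) \<sigma>) + int (n_neutral (range z) \<sigma>) - 1) simplex (separatrix C K) \<and>
    card (site_orbits (range z) \<sigma>) = n_pair (range z) \<sigma> + n_neutral (range z) \<sigma> \<and>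
    bij_betw (orbit_masses z \<sigma>) (separatrix C K)
      {t \<in> site_orbits (range z) \<sigma> \<rightarrow>\<^sub>E {0..}. (\<Sum>O'\<in>site_orbits (range z) \<sigma>. t O') = 1} \<and>
    (n_pair (range z) \<sigma> = 1 \<and> n_neutral (range z) \<sigma> = 0 \<longrightarrow>
       CARD('m) = 2 \<and> (\<exists>\<pi>. separatrix C K = {\<pi>}))"
proof -
  note z = assms(2)
  let ?b = "\<lambda>i. {z i, \<sigma> (z i)}"
  define \<tau> where "\<tau> i = inv z (\<sigma> (z i))" for i
  define q where "q i = sqrt (\<kappa> (z i))" for i
  \<comment> \<open>The ratio constraint says that \<open>q i * \<pi> $ i\<close> is constant on
    each orbit, so the profile is \<open>1 / q\<close> normalized there.\<close>
  define p where "p i = (1 / q i) / (\<Sum>j | ?b j = ?b i. 1 / q j)" for i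
  have inv: "\<sigma> w \<in> range z \<and> \<sigma> (\<sigma> w) = w" if "w \<in> range z" for w
    using assms(5) that by (auto simp: cond_S3_def)
  have z\<tau>: "z (\<tau> i) = \<sigma> (z i)" for i
    using inv[of "z i"] unfolding \<tau>_def by (auto intro: f_inv_into_f)
  have q: "q i > 0" for i
    using assms(5) by (auto simp: q_def cond_S3_def)
  have block: "{j. ?b j = ?b i} = {i, \<tau> i}" for i
  proof -
    have "?b j = ?b i \<longleftrightarrow> z j = z i \<or> z j = z (\<tau> i)" for j
      using orbit_eq_iff[of \<sigma> "z j" "z i"] inv by (simp add: z\<tau>)
    then show ?thesis
      using z by (auto dest: injD)
  qed
  have norm_pos: "(\<Sum>j | ?b j = ?b i. 1 / q j) > 0" for i
    using q by (intro sum_pos) auto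
  interpret block_profile ?b p
  proof
    show "p i > 0" for i
      using q norm_pos by (simp add: p_def)
    show "(\<Sum>i | ?b i = ?b j. p i) = 1" for j
    proof -
      let ?n = "\<Sum>i | ?b i = ?b j. 1 / q i"
      have "(\<Sum>i | ?b i = ?b j. p i) = (\<Sum>i | ?b i = ?b j. (1 / q i) / ?n)"
        by (rule sum.cong) (simp_all add: p_def)
      also have "\<dots> = ?n / ?n"
        by (rule sum_divide_distrib [symmetric])
      also have "\<dots> = 1"
        using norm_pos[of j] by (intro divide_self) (rule less_imp_neq [symmetric])
      finally show ?thesis .
    qed
  qed
  have orbits: "site_orbits (range z) \<sigma> = range ?b"
    by (auto simp: site_orbits_def)
  have mass: "block_mass \<pi> (?b i) = (\<Sum>j\<in>{i, \<tau> i}. \<pi> $ j)" for \<pi> i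
    unfolding block_mass_def block ..
  have profile_iff: "\<pi> $ i = p i * block_mass \<pi> (?b i) \<longleftrightarrow> q i * \<pi> $ i = q (\<tau> i) * \<pi> $ \<tau> i"
    for \<pi> i
  proof (cases "\<tau> i = i")
    case True
    \<comment> \<open>On a neutral site \<open>p i = 1\<close> and the block is \<open>{i}\<close>,
      so both equations hold trivially.\<close>
    then show ?thesis
      using q[of i] by (simp add: mass p_def block)
  next
    case False
    have "p i = q (\<tau> i) / (q i + q (\<tau> i))" (is "_ = ?r")
      using False q[of i] q[of "\<tau> i"] by (simp add: p_def block field_simps)
    moreover have "q i + q (\<tau> i) > 0"
      using q[of i] q[of "\<tau> i"] by simp
    then have "\<pi> $ i = ?r * (\<pi> $ i + \<pi> $ \<tau> i) \<longleftrightarrow> q i * \<pi> $ i = q (\<tau> i) * \<pi> $ \<tau> i"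
      by (simp add: field_simps)
    ultimately show ?thesis
      using False by (simp add: mass)
  qed
  have sep_iff: "\<pi> \<in> separatrix C K \<longleftrightarrow>
      (\<forall>w\<in>range z. sqrt (\<kappa> w) * site_mass z \<pi> w = sqrt (\<kappa> (\<sigma> w)) * site_mass z \<pi> (\<sigma> w))"
    if "\<pi> \<in> prob_simplex" for \<pi>
    using separatrix_iff_ratio[OF z assms(4-6) that] .
  have site_iff: "(\<forall>w\<in>range z. sqrt (\<kappa> w) * site_mass z \<pi> w = sqrt (\<kappa> (\<sigma> w)) * site_mass z \<pi> (\<sigma> w))
      \<longleftrightarrow> (\<forall>i. q i * \<pi> $ i = q (\<tau> i) * \<pi> $ \<tau> i)" for \<pi>
    using z by (simp add: site_mass_def q_def z\<tau> flip: \<tau>_def)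
  have sep: "separatrix C K = profile_set"
  proof -
    have "\<pi> \<in> separatrix C K \<longleftrightarrow> \<pi> \<in> profile_set" if "\<pi> \<in> prob_simplex" for \<pi>
      unfolding sep_iff[OF that] site_iff profile_set_def using that by (simp add: profile_iff)
    then show ?thesis
      by (auto simp: separatrix_def profile_set_def)
  qed
  have masses: "orbit_masses z \<sigma> \<pi> = restrict (block_mass \<pi>) (range ?b)" for \<pi>
    unfolding orbit_masses_def orbits
  proof (rule restrict_ext)
    fix Q assume "Q \<in> range ?b"
    then obtain i where Q: "Q = ?b i"
      by auto
    \<comment> \<open>This passes from sums over sites to sums over indices; writing the orbit as an
      image under the injective \<open>z\<close> treats both orbit sizes at once.\<close>
    have "Q = z ` {i, \<tau> i}"
      by (simp add: Q z\<tau>)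
    then have "(\<Sum>w\<in>Q. site_mass z \<pi> w) = (\<Sum>j\<in>{i, \<tau> i}. site_mass z \<pi> (z j))"
      by (simp only: sum.reindex[OF inj_on_subset[OF z subset_UNIV]] o_def)
    then show "(\<Sum>w\<in>Q. site_mass z \<pi> w) = block_mass \<pi> Q"
      using z unfolding Q mass by (simp add: site_mass_def)
  qed
  have card: "card (site_orbits (range z) \<sigma>) = n_pair (range z) \<sigma> + n_neutral (range z) \<sigma>"
    by (intro card_site_orbits inv) auto
  have simplex: "(int (n_pair (range z) \<sigma>) + int (n_neutral (range z) \<sigma>) - 1) simplex (separatrix C K)"
    using simplex_profile_set card by (simp add: sep orbits)
  have "bij_betw (orbit_masses z \<sigma>) (separatrix C K)
      {t \<in> site_orbits (range z) \<sigma> \<rightarrow>\<^sub>E {0..}. (\<Sum>O'\<in>site_orbits (range z) \<sigma>. t O') = 1}"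
    using bij_betw_block_mass unfolding sep orbits masses[abs_def] .
  moreover have "CARD('m) = 2 \<and> (\<exists>\<pi>. separatrix C K = {\<pi>})"
    if "n_pair (range z) \<sigma> = 1 \<and> n_neutral (range z) \<sigma> = 0"
  proof
    have "card (range z) = 2"
      using that by (intro card_sites_single_pair[where \<sigma> = \<sigma>] inv) auto
    then show "CARD('m) = 2"
      by (simp add: card_image z)
    show "\<exists>\<pi>. separatrix C K = {\<pi>}"
      \<comment> \<open>The dimension is 1 + 0 - 1 = 0, and a simplex of dimension 0 is a
        point.\<close>
      using simplex that by (simp add: simplex_zero)
  qed
  moreover have "\<pi> \<in> separatrix C K \<longleftrightarrow> (\<forall>w\<in>range z. \<sigma> w \<noteq> w \<longrightarrow>
      sqrt (\<kappa> w) * site_mass z \<pi> w = sqrt (\<kappa> (\<sigma> w)) * site_mass z \<pi> (\<sigma> w))"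
    if "\<pi> \<in> prob_simplex" for \<pi>
    \<comment> \<open>Where \<open>\<sigma> w = w\<close> the constraint is reflexive, so
      restricting it to moved sites changes nothing.\<close>
    unfolding sep_iff[OF that] by metis
  ultimately show ?thesis
    using card simplex convex_profile_set profile_set_nonempty by (simp add: sep)
qed

end
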